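(* For any $p\in[1,\infty]$, $(\mathcal{M},d_{\mathrm{GH}}^{(p)})$ is a $p$-metric space. That is, $d_{\mathrm{GH}}^{(p)}$ is a metric on the collection $\mathcal{M}$ of isometry classes of compact metric spaces, and for all $X,Y,Z\in\mathcal{M}$, $$d_{\mathrm{GH}}^{(p)}(X,Y)\leq d_{\mathrm{GH}}^{(p)}(X,Z)\boxplus_p d_{\mathrm{GH}}^{(p)}(Z,Y).$$
   Context: All metric spaces are nonempty. For $a,b\ge 0$: $a\boxplus_p b=(a^p+b^p)^{1/p}$ for $p\in[1,\infty)$ and $a\boxplus_\infty b=\max(a,b)$. A $p$-metric space is a metric space satisfying the $p$-triangle inequality $d(x,x'')\le d(x,x')\boxplus_p d(x',x'')$. For $a,b\ge0$: $\Lambda_p(a,b)=|a^p-b^p|^{1/p}$ for $p\in[1,\infty)$; $\Lambda_\infty(a,b)=\max(a,b)$ if $a\ne b$ and $0$ if $a=b$. For metric spaces $X,Y$, $$d_{\mathrm{GH}}^{(p)}(X,Y)=2^{-\frac1p}\inf_R\ \sup_{(x,y),(x',y')\in R}\Lambda_p(d_X(x,x'),d_Y(y,y')),$$ with $R$ ranging over all correspondences between $X$ and $Y$ (subsets of $X\times Y$ projecting onto both factors) and the convention $\frac1\infty=0$. *)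

theory Defs
  imports "HOL-Analysis.Analysis"
begin

text \<open>The exponent \<open>p\<close> ranges over \<open>[1,\<infinity>]\<close> and is represented as an extended real with \<open>1 \<le> p\<close>.
  The operations below are only used for nonnegative real arguments \<open>a\<close>, \<open>b\<close>, where
  \<open>a powr r\<close> with \<open>r > 0\<close> is the usual power (in particular \<open>0 powr r = 0\<close>).\<close>

definition boxplus :: "ereal \<Rightarrow> real \<Rightarrow> real \<Rightarrow> real" where
  "boxplus p a b =
     (if p = \<infinity> then max a b
      else (a powr real_of_ereal p + b powr real_of_ereal p) powr (1 / real_of_ereal p))"

definition Lam :: "ereal \<Rightarrow> real \<Rightarrow> real \<Rightarrow> real" where
  "Lam p a b =
     (if p = \<infinity> then (if a = b then 0 else max a b)
      else \<bar>a powr real_of_ereal p - b powr real_of_ereal p\<bar> powr (1 / real_of_ereal p))"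

definition p_metric_space :: "ereal \<Rightarrow> 'a set \<Rightarrow> ('a \<Rightarrow> 'a \<Rightarrow> real) \<Rightarrow> bool" where
  "p_metric_space p M d \<longleftrightarrow>
     M \<noteq> {} \<and> Metric_space M d \<and>
     (\<forall>x\<in>M. \<forall>x'\<in>M. \<forall>x''\<in>M. d x x'' \<le> boxplus p (d x x') (d x' x''))"

definition correspondences :: "'a set \<Rightarrow> 'b set \<Rightarrow> ('a \<times> 'b) set set" where
  "correspondences A B = {R. R \<subseteq> A \<times> B \<and> fst ` R = A \<and> snd ` R = B}"

text \<open>For unbounded spaces the value may be infinite, hence the type \<^typ>\<open>ennreal\<close>.
  In the factor \<open>2\<^bsup>-1/p\<^esup>\<close> the quotient is taken in \<^typ>\<open>ereal\<close>, where \<open>1 / \<infinity> = 0\<close>.\<close>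

definition dGH :: "ereal \<Rightarrow> 'a metric \<Rightarrow> 'b metric \<Rightarrow> ennreal" where
  "dGH p X Y =
     ennreal (2 powr (- real_of_ereal (1 / p))) *
     (INF R \<in> correspondences (mspace X) (mspace Y).
        SUP ((x, y), (x', y')) \<in> R \<times> R. ennreal (Lam p (mdist X x x') (mdist Y y y')))"

definition compact_metrics :: "'a metric set" where
  "compact_metrics = {X. mspace X \<noteq> {} \<and> compact_space (mtopology_of X)}"

definition isometric :: "'a metric \<Rightarrow> 'b metric \<Rightarrow> bool" where
  "isometric X Y \<longleftrightarrow>
     (\<exists>f. bij_betw f (mspace X) (mspace Y) \<and>
          (\<forall>x\<in>mspace X. \<forall>x'\<in>mspace X. mdist Y (f x) (f x') = mdist X x x'))"

definition isometry_rel :: "('a metric \<times> 'a metric) set" where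
  "isometry_rel = {(X, Y). X \<in> compact_metrics \<and> Y \<in> compact_metrics \<and> isometric X Y}"

text \<open>Isometry classes of compact metric spaces whose points are taken from the type \<^typ>\<open>'a\<close>.
  The type is arbitrary. A compact metric space has at most continuum many points, so as soon as
  \<^typ>\<open>'a\<close> has at least the cardinality of the reals, every compact metric space, over any type,
  is isometric to a member of one of these classes.\<close>

definition GH_classes :: "'a metric set set" where
  "GH_classes = compact_metrics // isometry_rel"

text \<open>The distance of two classes, computed from chosen representatives.\<close>

definition GH_dist :: "ereal \<Rightarrow> 'a metric set \<Rightarrow> 'a metric set \<Rightarrow> real" where
  "GH_dist p C D = enn2real (dGH p (SOME X. X \<in> C) (SOME Y. Y \<in> D))"

end

theory Submission
  imports Defs
begin

text \<open>The function \<open>\<Lambda>\<^sub>p\<close> is itself a \<open>p\<close>-metric on the nonnegative reals, so distortions are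
  \<open>p\<close>-subadditive under composition of correspondences, which gives the \<open>p\<close>-triangle inequality
  after passing to infima. Since \<open>\<bar>a - b\<bar> \<le> \<Lambda>\<^sub>p a b \<le> max a b\<close>, the distance is finite on compact
  spaces, and if it vanishes then there are \<open>\<epsilon>\<close>-isometric maps in both directions for every
  \<open>\<epsilon> > 0\<close>. By compactness these yield isometric embeddings in both directions, which are onto
  because an isometric self-embedding of a compact space is.\<close>

section \<open>The operations on real numbers\<close>

text \<open>Normalising by \<open>u + v\<close> leaves fractions in [0,1], which do not grow under a
  power of at least 1 and which sum to 1.\<close>

lemma powr_superadditive:
  fixes u v r :: real
  assumes "0 \<le> u" "0 \<le> v" "1 \<le> r"
  shows "u powr r + v powr r \<le> (u + v) powr r"
proof (cases "u + v = 0")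
  case True
  then have "u = 0" "v = 0" using assms by auto
  then show ?thesis by simp
next
  case False
  define s where "s = u + v"
  have s: "s > 0" using False assms by (simp add: s_def)
  have le: "w powr r \<le> w / s * s powr r" if "0 \<le> w" "w \<le> s" for w
  proof -
    have "(w / s) powr r \<le> (w / s) powr 1"
      using that s assms by (intro powr_mono') auto
    then have "(w / s) powr r * s powr r \<le> w / s * s powr r"
      using that s by (intro mult_right_mono) auto
    then show ?thesis using that s by (simp add: powr_divide)
  qed
  have "u powr r + v powr r \<le> u / s * s powr r + v / s * s powr r"
    using assms by (intro add_mono le) (auto simp: s_def)
  also have "\<dots> = s powr r"
    using s by (simp add: s_def flip: distrib_right add_divide_distrib)
  finally show ?thesis by (simp add: s_def)
qed

lemma ereal_ge_1_cases:
  fixes p :: ereal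
  assumes "1 \<le> p"
  obtains (real) r where "p = ereal r" "1 \<le> r" | (PInf) "p = \<infinity>"
  using assms by (cases p) (auto simp: one_ereal_def)

lemma Lam_nonneg: "0 \<le> a \<Longrightarrow> 0 \<le> b \<Longrightarrow> 0 \<le> Lam p a b"
  by (auto simp: Lam_def)

lemma Lam_commute: "Lam p a b = Lam p b a"
  by (auto simp: Lam_def max.commute abs_minus_commute)

lemma Lam_same [simp]: "Lam p a a = 0"
  by (simp add: Lam_def)

text \<open>Both powers lie between 0 and the power of the maximum, so their absolute difference
  does too. This bounds distortions by diameters.\<close>

lemma Lam_le_max:
  assumes "1 \<le> p" "0 \<le> a" "0 \<le> b"
  shows "Lam p a b \<le> max a b"
  using assms(1)
proof (cases rule: ereal_ge_1_cases)
  case (real r)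
  have "\<bar>a powr r - b powr r\<bar> \<le> max a b powr r"
    using assms real powr_mono2[of r a "max a b"] powr_mono2[of r b "max a b"]
      powr_ge_zero[of a r] powr_ge_zero[of b r] by linarith
  then have "\<bar>a powr r - b powr r\<bar> powr (1/r) \<le> (max a b powr r) powr (1/r)"
    using real by (intro powr_mono2) auto
  then show ?thesis using assms real by (simp add: Lam_def powr_powr)
qed (use assms in \<open>simp add: Lam_def\<close>)

text \<open>For finite \<open>p\<close> this is superadditivity for \<open>(a - b) + b\<close>. It
  turns a small distortion into a small additive error, whatever \<open>p\<close> is.\<close>

lemma abs_diff_le_Lam:
  assumes "1 \<le> p" "0 \<le> a" "0 \<le> b"
  shows "\<bar>a - b\<bar> \<le> Lam p a b"
proof -
  have *: "a - b \<le> Lam p a b" if "0 \<le> b" "b \<le> a" for a b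
    using assms(1)
  proof (cases rule: ereal_ge_1_cases)
    case (real r)
    have "(a - b) powr r \<le> \<bar>a powr r - b powr r\<bar>"
      using powr_superadditive[of "a - b" b r] that real by simp
    then have "((a - b) powr r) powr (1/r) \<le> \<bar>a powr r - b powr r\<bar> powr (1/r)"
      using real by (intro powr_mono2) auto
    then show ?thesis using that real by (simp add: Lam_def powr_powr)
  qed (use that in \<open>simp add: Lam_def\<close>)
  show ?thesis
    using *[of a b] *[of b a] assms Lam_commute[of p a b] by (cases "a \<le> b") auto
qed

lemma boxplus_mono:
  assumes "1 \<le> p" "0 \<le> a" "a \<le> a'" "0 \<le> b" "b \<le> b'"
  shows "boxplus p a b \<le> boxplus p a' b'"
  using assms(1)
proof (cases rule: ereal_ge_1_cases)
  case (real r)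
  then show ?thesis
    using assms by (auto simp: boxplus_def intro!: powr_mono2 add_mono)
qed (use assms in \<open>auto simp: boxplus_def\<close>)

lemma boxplus_nonneg: "0 \<le> a \<Longrightarrow> 0 \<le> b \<Longrightarrow> 0 \<le> boxplus p a b"
  by (auto simp: boxplus_def)

lemma boxplus_0:
  assumes "1 \<le> p" "0 \<le> a"
  shows "boxplus p 0 a = a" "boxplus p a 0 = a"
  using assms by (cases p rule: ereal_ge_1_cases; simp add: boxplus_def powr_powr)+

text \<open>Superadditivity under the root; it makes the p-triangle inequality imply the ordinary
  one.\<close>

lemma boxplus_le_add:
  assumes "1 \<le> p" "0 \<le> a" "0 \<le> b"
  shows "boxplus p a b \<le> a + b"
  using assms(1)
proof (cases rule: ereal_ge_1_cases)
  case (real r)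
  have "(a powr r + b powr r) powr (1/r) \<le> ((a + b) powr r) powr (1/r)"
    using real assms by (intro powr_mono2 powr_superadditive) auto
  then show ?thesis using real assms by (simp add: boxplus_def powr_powr)
qed (use assms in \<open>simp add: boxplus_def\<close>)

text \<open>Homogeneity carries the factor 2^(-1/p) of \<open>dGH\<close> through the p-triangle
  inequality.\<close>

lemma boxplus_mult_left:
  assumes "1 \<le> p" "0 \<le> a" "0 \<le> b" "0 \<le> c"
  shows "c * boxplus p a b = boxplus p (c * a) (c * b)"
  using assms(1)
proof (cases rule: ereal_ge_1_cases)
  case (real r)
  have "((c * a) powr r + (c * b) powr r) powr (1/r) = (c powr r * (a powr r + b powr r)) powr (1/r)"
    using assms by (simp add: powr_mult distrib_left)
  also have "\<dots> = c * (a powr r + b powr r) powr (1/r)"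
    using assms real by (simp add: powr_mult powr_powr)
  finally show ?thesis using real by (simp add: boxplus_def)
qed (use assms in \<open>simp add: boxplus_def max_mult_distrib_left\<close>)

text \<open>For finite \<open>p\<close>, this is the usual triangle inequality between the powers of
  \<open>a\<close>, \<open>b\<close>, \<open>c\<close>, under a root. For
  \<open>p = \<infinity>\<close>, it is a case split on which of the numbers coincide.\<close>

lemma Lam_triangle:
  assumes "1 \<le> p" "0 \<le> a" "0 \<le> b" "0 \<le> c"
  shows "Lam p a c \<le> boxplus p (Lam p a b) (Lam p b c)"
  using assms(1)
proof (cases rule: ereal_ge_1_cases)
  case (real r)
  have "\<bar>a powr r - c powr r\<bar> powr (1/r)
      \<le> (\<bar>a powr r - b powr r\<bar> + \<bar>b powr r - c powr r\<bar>) powr (1/r)"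
    using real by (intro powr_mono2) auto
  then show ?thesis using real by (simp add: Lam_def boxplus_def powr_powr)
qed (use assms in \<open>auto simp: Lam_def boxplus_def\<close>)

text \<open>The right-hand limit matches infima approximated from above and keeps the bases of
  \<open>powr\<close> nonnegative, so that base 0 causes no trouble.\<close>

lemma tendsto_boxplus_at_right:
  assumes "1 \<le> p" "0 \<le> a" "0 \<le> b"
  shows "((\<lambda>\<delta>. boxplus p (a + \<delta>) (b + \<delta>)) \<longlongrightarrow> boxplus p a b) (at_right 0)"
proof -
  have pos: "\<forall>\<^sub>F \<delta> in at_right (0::real). 0 < \<delta>"
    by (rule eventually_at_right_less)
  have lim: "((\<lambda>\<delta>. u + \<delta>) \<longlongrightarrow> u) (at_right 0)" for u :: real
    using tendsto_add[OF tendsto_const[of u] tendsto_ident_at[of 0 "{0<..}"]] by simp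
  show ?thesis
    using assms(1)
  proof (cases rule: ereal_ge_1_cases)
    case (real r)
    have powr: "((\<lambda>\<delta>. (u + \<delta>) powr r) \<longlongrightarrow> u powr r) (at_right 0)" if "0 \<le> u" for u
      using real that by (intro tendsto_powr2 lim tendsto_const eventually_mono[OF pos]) auto
    have "((\<lambda>\<delta>. ((a + \<delta>) powr r + (b + \<delta>) powr r) powr (1/r))
        \<longlongrightarrow> (a powr r + b powr r) powr (1/r)) (at_right 0)"
      by (rule tendsto_powr2[OF tendsto_add[OF powr powr] tendsto_const]) (use real assms in auto)
    then show ?thesis using real by (simp add: boxplus_def)
  next
    case PInf
    then show ?thesis
      using tendsto_max[OF lim lim, of a b] by (simp add: boxplus_def)
  qed
qed

section \<open>Correspondences\<close>

text \<open>Together with \<open>dGH_lessD\<close>, this replaces the infimum and supremum by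
  statements about single correspondences. The bound there is strict because no minimiser is assumed
  to exist.\<close>

lemma dGH_le:
  assumes "R \<in> correspondences (mspace X) (mspace Y)"
    and "\<And>x y x' y'. (x, y) \<in> R \<Longrightarrow> (x', y') \<in> R \<Longrightarrow> Lam p (mdist X x x') (mdist Y y y') \<le> e"
    and "0 \<le> e"
  shows "dGH p X Y \<le> ennreal (2 powr (- real_of_ereal (1 / p)) * e)"
proof -
  have "(SUP ((x, y), (x', y')) \<in> R \<times> R. ennreal (Lam p (mdist X x x') (mdist Y y y'))) \<le> ennreal e"
    using assms(2) by (intro SUP_least) (auto intro: ennreal_leI)
  then show ?thesis
    unfolding dGH_def ennreal_mult''[OF \<open>0 \<le> e\<close>]
    using assms(1) by (intro mult_left_mono INF_lower2[of R]) auto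
qed

lemma dGH_lessD:
  assumes "dGH p X Y < ennreal (2 powr (- real_of_ereal (1 / p)) * e)" and "0 \<le> e"
  obtains R where "R \<in> correspondences (mspace X) (mspace Y)"
    "\<And>x y x' y'. (x, y) \<in> R \<Longrightarrow> (x', y') \<in> R \<Longrightarrow> Lam p (mdist X x x') (mdist Y y y') \<le> e"
proof -
  let ?S = "\<lambda>R. SUP ((x, y), (x', y')) \<in> R \<times> R. ennreal (Lam p (mdist X x x') (mdist Y y y'))"
  \<comment> \<open>By contraposition: were the infimum at least \<open>e\<close>, scaling it would
    contradict the assumed bound. This avoids division in \<open>ennreal\<close>.\<close>
  have "(INF R \<in> correspondences (mspace X) (mspace Y). ?S R) < ennreal e"
    using assms(1) unfolding dGH_def ennreal_mult''[OF \<open>0 \<le> e\<close>]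
    by (meson mult_left_mono not_less zero_le)
  then obtain R where R: "R \<in> correspondences (mspace X) (mspace Y)" "?S R < ennreal e"
    by (auto simp: INF_less_iff)
  show thesis
  proof (rule that[OF R(1)])
    fix x y x' y' assume "(x, y) \<in> R" "(x', y') \<in> R"
    then have "ennreal (Lam p (mdist X x x') (mdist Y y y')) \<le> ?S R"
      by (intro SUP_upper2[of "((x, y), (x', y'))"]) auto
    then have "ennreal (Lam p (mdist X x x') (mdist Y y y')) \<le> ennreal e"
      using R(2) by simp
    then show "Lam p (mdist X x x') (mdist Y y y') \<le> e"
      using \<open>0 \<le> e\<close> by (simp add: ennreal_le_iff)
  qed
qed

lemma correspondences_iff:
  "R \<in> correspondences A B \<longleftrightarrow>
    R \<subseteq> A \<times> B \<and> (\<forall>a\<in>A. \<exists>b. (a, b) \<in> R) \<and> (\<forall>b\<in>B. \<exists>a. (a, b) \<in> R)"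
proof -
  have "fst ` R = Domain R" "snd ` R = Range R"
    by (simp_all add: Domain_fst Range_snd)
  then show ?thesis unfolding correspondences_def by blast
qed

lemma correspondences_converse:
  "R \<in> correspondences A B \<Longrightarrow> R\<inverse> \<in> correspondences B A"
  unfolding correspondences_iff by blast

lemma correspondences_relcomp:
  "R \<in> correspondences A B \<Longrightarrow> S \<in> correspondences B C \<Longrightarrow> R O S \<in> correspondences A C"
  unfolding correspondences_iff by blast

section \<open>Finiteness on compact spaces and real-valued distances\<close>

lemma compact_metrics_bounded:
  assumes "X \<in> compact_metrics"
  obtains B where "0 \<le> B" "\<And>x y. x \<in> mspace X \<Longrightarrow> y \<in> mspace X \<Longrightarrow> mdist X x y \<le> B"
proof -
  interpret Metric_space "mspace X" "mdist X" by simp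
  have "mbounded (mspace X)"
    using assms by (intro compactin_imp_mbounded)
      (simp add: compact_metrics_def compact_space_def mtopology_of_def)
  then show thesis
    using that unfolding mbounded_alt_pos by (meson less_imp_le)
qed

text \<open>The full product is a correspondence because both spaces are nonempty, and its
  distortion is at most the larger diameter bound.\<close>

lemma dGH_finite:
  assumes "1 \<le> p" "X \<in> compact_metrics" "Y \<in> compact_metrics"
  shows "dGH p X Y < top"
proof -
  obtain B where B: "0 \<le> B" "\<And>x y. x \<in> mspace X \<Longrightarrow> y \<in> mspace X \<Longrightarrow> mdist X x y \<le> B"
    using compact_metrics_bounded[OF assms(2)] by blast
  obtain C where C: "0 \<le> C" "\<And>x y. x \<in> mspace Y \<Longrightarrow> y \<in> mspace Y \<Longrightarrow> mdist Y x y \<le> C"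
    using compact_metrics_bounded[OF assms(3)] by blast
  have "mspace X \<times> mspace Y \<in> correspondences (mspace X) (mspace Y)"
    using assms by (auto simp: correspondences_def compact_metrics_def)
  moreover have "Lam p (mdist X x x') (mdist Y y y') \<le> max B C"
    if "(x, y) \<in> mspace X \<times> mspace Y" "(x', y') \<in> mspace X \<times> mspace Y" for x y x' y'
    using that B C assms by (intro order_trans[OF Lam_le_max] max.mono) auto
  ultimately have "dGH p X Y \<le> ennreal (2 powr (- real_of_ereal (1 / p)) * max B C)"
    using B by (intro dGH_le) auto
  then show ?thesis using le_less_trans by fastforce
qed

lemma ennreal_enn2real_dGH:
  assumes "1 \<le> p" "X \<in> compact_metrics" "Y \<in> compact_metrics"
  shows "ennreal (enn2real (dGH p X Y)) = dGH p X Y"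
  using dGH_finite[OF assms] by simp

lemma enn2real_dGH_le:
  assumes "R \<in> correspondences (mspace X) (mspace Y)"
    and "\<And>x y x' y'. (x, y) \<in> R \<Longrightarrow> (x', y') \<in> R \<Longrightarrow> Lam p (mdist X x x') (mdist Y y y') \<le> e"
    and "0 \<le> e"
  shows "enn2real (dGH p X Y) \<le> 2 powr (- real_of_ereal (1 / p)) * e"
  using enn2real_mono[OF dGH_le[OF assms]] assms(3) by simp

lemma enn2real_dGH_lessD:
  assumes "1 \<le> p" "X \<in> compact_metrics" "Y \<in> compact_metrics"
    and "enn2real (dGH p X Y) < 2 powr (- real_of_ereal (1 / p)) * e"
  obtains R where "R \<in> correspondences (mspace X) (mspace Y)"
    "\<And>x y x' y'. (x, y) \<in> R \<Longrightarrow> (x', y') \<in> R \<Longrightarrow> Lam p (mdist X x x') (mdist Y y y') \<le> e"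
proof -
  \<comment> \<open>A strict upper bound of a nonnegative number is positive, which supplies the
    sign condition of \<open>dGH_lessD\<close>.\<close>
  have pos: "0 < 2 powr (- real_of_ereal (1 / p)) * e"
    using assms(4) enn2real_nonneg le_less_trans by blast
  then have "0 \<le> e" by (simp add: zero_less_mult_iff)
  have "dGH p X Y < ennreal (2 powr (- real_of_ereal (1 / p)) * e)"
    using ennreal_lessI[OF _ assms(4)] pos ennreal_enn2real_dGH[OF assms(1-3)] by simp
  then show thesis using \<open>0 \<le> e\<close> by (rule dGH_lessD) (rule that)
qed

section \<open>Metric properties\<close>

lemma dGH_commute: "dGH p X Y = dGH p Y X"
proof -
  \<comment> \<open>The fresh type variables allow instantiation in both directions although
    \<open>X\<close> and \<open>Y\<close> may have different point types.\<close>
  have *: "dGH p Y X \<le> dGH p X Y" for X :: "'c metric" and Y :: "'d metric"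
    unfolding dGH_def
  proof (rule mult_left_mono, rule INF_greatest)
    fix R assume R: "R \<in> correspondences (mspace X) (mspace Y)"
    have "(SUP ((y, x), (y', x')) \<in> R\<inverse> \<times> R\<inverse>. ennreal (Lam p (mdist Y y y') (mdist X x x')))
      \<le> (SUP ((x, y), (x', y')) \<in> R \<times> R. ennreal (Lam p (mdist X x x') (mdist Y y y')))"
    proof (rule SUP_least)
      fix z assume "z \<in> R\<inverse> \<times> R\<inverse>"
      then obtain x y x' y' where z: "z = ((y, x), (y', x'))" "(x, y) \<in> R" "(x', y') \<in> R"
        by (cases z) auto
      show "(\<lambda>((y, x), (y', x')). ennreal (Lam p (mdist Y y y') (mdist X x x'))) z
        \<le> (SUP ((x, y), (x', y')) \<in> R \<times> R. ennreal (Lam p (mdist X x x') (mdist Y y y')))"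
        by (rule SUP_upper2[of "((x, y), (x', y'))"]) (use z in \<open>auto simp: Lam_commute\<close>)
    qed
    then show "(INF R \<in> correspondences (mspace Y) (mspace X).
        SUP ((y, x), (y', x')) \<in> R \<times> R. ennreal (Lam p (mdist Y y y') (mdist X x x')))
      \<le> (SUP ((x, y), (x', y')) \<in> R \<times> R. ennreal (Lam p (mdist X x x') (mdist Y y y')))"
      by (rule INF_lower2[OF correspondences_converse[OF R]])
  qed simp
  show ?thesis using *[of X Y] *[of Y X] by (rule order_antisym)
qed

text \<open>Nearly optimal correspondences are composed; the intermediate points of \<open>Y\<close>
  let \<open>Lam_triangle\<close> combine the two distortions.\<close>

lemma dGH_triangle:
  fixes X :: "'a metric" and Y :: "'b metric" and Z :: "'c metric"
  assumes p: "1 \<le> p" and "X \<in> compact_metrics" "Y \<in> compact_metrics" "Z \<in> compact_metrics"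
  shows "enn2real (dGH p X Z) \<le> boxplus p (enn2real (dGH p X Y)) (enn2real (dGH p Y Z))"
proof -
  define c where "c = 2 powr (- real_of_ereal (1 / p))"
  \<comment> \<open>Dividing by \<open>c\<close> recovers the infimal distortions, to which the
    pointwise bounds apply.\<close>
  define a where "a = enn2real (dGH p X Y) / c"
  define b where "b = enn2real (dGH p Y Z) / c"
  have c: "c > 0" by (simp add: c_def)
  have ab: "0 \<le> a" "0 \<le> b" using c by (simp_all add: a_def b_def)
  have "enn2real (dGH p X Z) \<le> c * boxplus p (a + \<delta>) (b + \<delta>)" if "0 < \<delta>" for \<delta>
  proof -
    have less: "enn2real (dGH p X Y) < c * (a + \<delta>)" "enn2real (dGH p Y Z) < c * (b + \<delta>)"
      using c that by (simp_all add: a_def b_def distrib_left)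
    obtain R where
      R: "R \<in> correspondences (mspace X) (mspace Y)"
        "\<And>x y x' y'. (x, y) \<in> R \<Longrightarrow> (x', y') \<in> R \<Longrightarrow> Lam p (mdist X x x') (mdist Y y y') \<le> a + \<delta>"
      using less(1) unfolding c_def by (elim enn2real_dGH_lessD[OF p assms(2,3)]) blast
    obtain S where S: "S \<in> correspondences (mspace Y) (mspace Z)"
        "\<And>x y x' y'. (x, y) \<in> S \<Longrightarrow> (x', y') \<in> S \<Longrightarrow> Lam p (mdist Y x x') (mdist Z y y') \<le> b + \<delta>"
      using less(2) unfolding c_def by (elim enn2real_dGH_lessD[OF p assms(3,4)]) blast
    show ?thesis
      unfolding c_def
    proof (rule enn2real_dGH_le[OF correspondences_relcomp[OF R(1) S(1)]])
      fix x z x' z' assume "(x, z) \<in> R O S" "(x', z') \<in> R O S"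
      then obtain y y' where xy: "(x, y) \<in> R" "(y, z) \<in> S" "(x', y') \<in> R" "(y', z') \<in> S"
        by blast
      have "Lam p (mdist X x x') (mdist Z z z')
          \<le> boxplus p (Lam p (mdist X x x') (mdist Y y y')) (Lam p (mdist Y y y') (mdist Z z z'))"
        by (rule Lam_triangle[OF p]) auto
      also have "\<dots> \<le> boxplus p (a + \<delta>) (b + \<delta>)"
        using xy R(2) S(2) by (intro boxplus_mono p Lam_nonneg) auto
      finally show "Lam p (mdist X x x') (mdist Z z z') \<le> boxplus p (a + \<delta>) (b + \<delta>)" .
    next
      show "0 \<le> boxplus p (a + \<delta>) (b + \<delta>)"
        using ab that by (intro boxplus_nonneg) auto
    qed
  qed
  \<comment> \<open>The slack \<delta> disappears in the limit.\<close>
  then have "\<forall>\<^sub>F \<delta> in at_right 0. enn2real (dGH p X Z) \<le> c * boxplus p (a + \<delta>) (b + \<delta>)"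
    by (intro eventually_mono[OF eventually_at_right_less])
  moreover have "((\<lambda>\<delta>. c * boxplus p (a + \<delta>) (b + \<delta>)) \<longlongrightarrow> c * boxplus p a b) (at_right 0)"
    by (intro tendsto_mult_left tendsto_boxplus_at_right p ab)
  ultimately have "enn2real (dGH p X Z) \<le> c * boxplus p a b"
    by (intro tendsto_lowerbound) auto
  also have "\<dots> = boxplus p (c * a) (c * b)"
    using c by (intro boxplus_mult_left p ab) auto
  finally show ?thesis using c by (simp add: a_def b_def)
qed

section \<open>Isometries\<close>

lemma isometric_refl: "isometric X X"
  unfolding isometric_def by (intro exI[of _ id]) auto

lemma isometric_sym:
  assumes "isometric X Y"
  shows "isometric Y X"
proof -
  obtain f where f: "bij_betw f (mspace X) (mspace Y)"
    "\<And>x x'. x \<in> mspace X \<Longrightarrow> x' \<in> mspace X \<Longrightarrow> mdist Y (f x) (f x') = mdist X x x'"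
    using assms unfolding isometric_def by blast
  define g where "g = inv_into (mspace X) f"
  have "bij_betw g (mspace Y) (mspace X)" unfolding g_def by (rule bij_betw_inv_into[OF f(1)])
  moreover have "mdist X (g y) (g y') = mdist Y y y'" if "y \<in> mspace Y" "y' \<in> mspace Y" for y y'
    using that f(2)[of "g y" "g y'"] bij_betw_inv_into_right[OF f(1)]
      bij_betwE[OF \<open>bij_betw g (mspace Y) (mspace X)\<close>] by (simp add: g_def)
  ultimately show ?thesis unfolding isometric_def by blast
qed

lemma isometric_trans:
  assumes "isometric X Y" "isometric Y Z"
  shows "isometric X Z"
proof -
  obtain f where f: "bij_betw f (mspace X) (mspace Y)"
    "\<And>x x'. x \<in> mspace X \<Longrightarrow> x' \<in> mspace X \<Longrightarrow> mdist Y (f x) (f x') = mdist X x x'"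
    using assms unfolding isometric_def by blast
  obtain g where g: "bij_betw g (mspace Y) (mspace Z)"
    "\<And>x x'. x \<in> mspace Y \<Longrightarrow> x' \<in> mspace Y \<Longrightarrow> mdist Z (g x) (g x') = mdist Y x x'"
    using assms unfolding isometric_def by blast
  show ?thesis unfolding isometric_def
    using bij_betw_trans[OF f(1) g(1)] f(2) g(2) bij_betwE[OF f(1)]
    by (intro exI[of _ "g \<circ> f"]) auto
qed

lemma equiv_isometry_rel: "equiv compact_metrics isometry_rel"
proof (rule equivI)
  show "sym isometry_rel"
    using isometric_sym by (auto simp: isometry_rel_def intro!: symI)
  show "trans isometry_rel"
    using isometric_trans by (fastforce simp: isometry_rel_def intro!: transI)
qed (auto simp: isometry_rel_def refl_on_def isometric_refl)

text \<open>The graph of an isometry is a correspondence of distortion 0.\<close>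

lemma isometric_imp_dGH_eq_0:
  assumes "isometric X Y"
  shows "dGH p X Y = 0"
proof -
  obtain f where f: "bij_betw f (mspace X) (mspace Y)"
    "\<And>x x'. x \<in> mspace X \<Longrightarrow> x' \<in> mspace X \<Longrightarrow> mdist Y (f x) (f x') = mdist X x x'"
    using assms unfolding isometric_def by blast
  have "(\<lambda>x. (x, f x)) ` mspace X \<in> correspondences (mspace X) (mspace Y)"
    using f(1) by (auto simp: correspondences_def bij_betw_def image_image)
  then have "dGH p X Y \<le> ennreal (2 powr (- real_of_ereal (1 / p)) * 0)"
    by (rule dGH_le) (auto simp: f(2))
  then show ?thesis by simp
qed

text \<open>The constraints on \<open>f\<close> define closed subsets of a product of copies of \<open>Y\<close> with the finite
  intersection property, so Tychonoff's theorem provides an \<open>f\<close> satisfying all of them.\<close>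

lemma almost_isometric_embeddings_imp_isometric_embedding:
  fixes X :: "'a metric" and Y :: "'b metric"
  assumes Y: "compact_space (mtopology_of Y)"
    and approx: "\<And>e. e > 0 \<Longrightarrow> \<exists>f \<in> mspace X \<rightarrow> mspace Y. \<forall>x \<in> mspace X. \<forall>x' \<in> mspace X.
        \<bar>mdist Y (f x) (f x') - mdist X x x'\<bar> \<le> e"
  shows "\<exists>f \<in> mspace X \<rightarrow> mspace Y. \<forall>x \<in> mspace X. \<forall>x' \<in> mspace X.
        mdist Y (f x) (f x') = mdist X x x'"
proof -
  define P where "P = product_topology (\<lambda>_. mtopology_of Y) (mspace X)"
  \<comment> \<open>Each index is one constraint: a pair of points and a tolerance.\<close>
  define C where "C = (\<lambda>(x, x', e). {f \<in> topspace P. \<bar>mdist Y (f x) (f x') - mdist X x x'\<bar> \<in> {..e}})"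
  define I where "I = mspace X \<times> mspace X \<times> {0::real<..}"
  have "compact_space P"
    unfolding P_def using Y by (simp add: compact_space_product_topology)
  moreover have "closedin P (C i)" if I: "i \<in> I" for i
  proof -
    obtain x x' e where i: "i = (x, x', e)" "x \<in> mspace X" "x' \<in> mspace X"
      using I by (cases i) (auto simp: I_def)
    have "continuous_map P (mtopology_of Y) (\<lambda>f. f z)" if "z \<in> mspace X" for z
      unfolding P_def using that by (rule continuous_map_product_projection)
    then have "continuous_map P euclideanreal (\<lambda>f. \<bar>mdist Y (f x) (f x') - mdist X x x'\<bar>)"
      using i by (intro continuous_map_real_abs continuous_map_diff continuous_map_mdist) auto
    then show ?thesis
      unfolding i(1) C_def prod.case
      by (rule closedin_continuous_map_preimage) simp
  qed
  moreover have "\<Inter>\<F> \<noteq> {}" if "finite \<F>" "\<F> \<subseteq> C ` I" for \<F>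
  proof -
    obtain K where K: "K \<subseteq> I" "finite K" "\<F> = C ` K"
      using finite_subset_image[OF \<open>finite \<F>\<close> \<open>\<F> \<subseteq> C ` I\<close>] by blast
    \<comment> \<open>The smallest of finitely many tolerances; the inserted 1 covers an empty
      \<open>K\<close>.\<close>
    define e where "e = Min (insert 1 ((\<lambda>(x, x', e). e) ` K))"
    have "e > 0" using K by (auto simp: e_def I_def)
    then obtain f where f: "f \<in> mspace X \<rightarrow> mspace Y"
      "\<And>x x'. x \<in> mspace X \<Longrightarrow> x' \<in> mspace X \<Longrightarrow> \<bar>mdist Y (f x) (f x') - mdist X x x'\<bar> \<le> e"
      using approx by blast
    \<comment> \<open>Points of the product topology are extensional functions, hence the
      restriction.\<close>
    have "restrict f (mspace X) \<in> C k" if k_in: "k \<in> K" for k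
    proof -
      obtain x x' e' where k: "k = (x, x', e')" "x \<in> mspace X" "x' \<in> mspace X"
        using k_in K(1) by (cases k) (auto simp: I_def)
      have "e \<le> e'"
        unfolding e_def using K(2) k_in k(1) by (intro Min_le) (auto simp: rev_image_eqI)
      then show ?thesis
        using f(1) f(2)[OF k(2,3)] k by (auto simp: C_def P_def)
    qed
    then show ?thesis using K(3) by blast
  qed
  ultimately have "\<Inter>(C ` I) \<noteq> {}"
    unfolding compact_space_fip by blast
  then obtain f where f: "\<And>i. i \<in> I \<Longrightarrow> f \<in> C i" by blast
  have le: "\<bar>mdist Y (f x) (f x') - mdist X x x'\<bar> \<le> e" if "x \<in> mspace X" "x' \<in> mspace X" "e > 0" for x x' e
    using f[of "(x, x', e)"] that by (simp add: C_def I_def)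
  have "mdist Y (f x) (f x') = mdist X x x'" if "x \<in> mspace X" "x' \<in> mspace X" for x x'
    using field_le_epsilon[of "\<bar>mdist Y (f x) (f x') - mdist X x x'\<bar>" 0] le[OF that] by simp
  \<comment> \<open>Every \<open>C i\<close> lies in the topspace of \<open>P\<close>, so the
    trivial constraint on the pair \<open>(x, x)\<close> already yields membership.\<close>
  moreover have "f \<in> mspace X \<rightarrow> mspace Y"
  proof
    fix x assume "x \<in> mspace X"
    then show "f x \<in> mspace Y"
      using f[of "(x, x, 1)"] by (auto simp: C_def I_def P_def)
  qed
  ultimately show ?thesis by blast
qed

text \<open>If \<open>x\<close> is not in the image, then it has positive distance to the image, so the orbit of \<open>x\<close>
  is uniformly separated.\<close>

lemma (in Metric_space) isometric_self_embedding_surj: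
  assumes comp: "compact_space mtopology"
    and fM: "f \<in> M \<rightarrow> M"
    and iso: "\<And>x y. x \<in> M \<Longrightarrow> y \<in> M \<Longrightarrow> d (f x) (f y) = d x y"
  shows "f ` M = M"
proof (rule ccontr)
  assume "f ` M \<noteq> M"
  then obtain x where x: "x \<in> M" "x \<notin> f ` M" using fM by blast
  have "continuous_map mtopology mtopology f"
    unfolding metric_continuous_map[OF Metric_space_axioms] using fM iso by (auto; metis)
  then have "compactin mtopology (f ` M)"
    using comp image_compactin by (fastforce simp: compact_space_def)
  then have "closedin mtopology (f ` M)"
    by (simp add: compactin_imp_closedin Hausdorff_space_mtopology)
  then obtain r where r: "r > 0" "disjnt (f ` M) (mball x r)"
    using x unfolding closedin_metric by blast
  have orbit: "(f ^^ n) x \<in> M" for n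
    using x fM by (induction n) auto
  \<comment> \<open>Cancelling \<open>n\<close> applications of the isometry turns every distance
    within the orbit into a distance from \<open>x\<close>.\<close>
  have shift: "d ((f ^^ n) x) ((f ^^ (n + k)) x) = d x ((f ^^ k) x)" for n k
    using orbit iso by (induction n) auto
  \<comment> \<open>Iterates of positive index lie in the image of \<open>f\<close>, hence outside
    the ball around \<open>x\<close>.\<close>
  have "r \<le> d x ((f ^^ Suc k) x)" for k
    using r(2) x(1) orbit[of k] orbit[of "Suc k"] by (force simp: disjnt_iff)
  then have sep: "r \<le> d ((f ^^ n) x) ((f ^^ m) x)" if "n < m" for m n
    using shift[of n "m - n"] that by (metis Suc_diff_Suc le_add_diff_inverse less_imp_le)
  \<comment> \<open>A convergent subsequence of the orbit is Cauchy, against the separation by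
    \<open>r\<close>.\<close>
  obtain l s where s: "strict_mono s" "limitin mtopology ((\<lambda>n. (f ^^ n) x) \<circ> s) l sequentially"
    using comp orbit unfolding compact_space_sequentially by (metis image_subsetI)
  have "MCauchy ((\<lambda>n. (f ^^ n) x) \<circ> s)"
    using s(2) orbit by (intro convergent_imp_MCauchy) auto
  then obtain N where "\<And>n n'. N \<le> n \<Longrightarrow> N \<le> n' \<Longrightarrow> d ((f ^^ s n) x) ((f ^^ s n') x) < r"
    using r(1) unfolding MCauchy_def comp_def by meson
  then have "d ((f ^^ s N) x) ((f ^^ s (Suc N)) x) < r" by simp
  moreover have "s N < s (Suc N)" using s(1) by (simp add: strict_mono_Suc_iff)
  ultimately show False using sep by (meson not_less)
qed

text \<open>\<open>f \<circ> g\<close> is an isometric self-embedding of \<open>Y\<close>, hence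
  onto, which forces \<open>f\<close> to be onto; preserved distances make \<open>f\<close>
  injective.\<close>

lemma isometric_if_embeddings:
  assumes Y: "compact_space (mtopology_of Y)"
    and f: "f \<in> mspace X \<rightarrow> mspace Y" "\<forall>x \<in> mspace X. \<forall>x' \<in> mspace X. mdist Y (f x) (f x') = mdist X x x'"
    and g: "g \<in> mspace Y \<rightarrow> mspace X" "\<forall>y \<in> mspace Y. \<forall>y' \<in> mspace Y. mdist X (g y) (g y') = mdist Y y y'"
  shows "isometric X Y"
proof -
  interpret Y: Metric_space "mspace Y" "mdist Y" by simp
  have "(f \<circ> g) ` mspace Y = mspace Y"
    using Y f g by (intro Y.isometric_self_embedding_surj) (auto simp: mtopology_of_def Pi_iff)
  then have "mspace Y \<subseteq> f ` mspace X" using g(1) by (force simp only: image_comp[symmetric] Pi_iff)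
  then have "f ` mspace X = mspace Y" using f(1) by blast
  moreover have "inj_on f (mspace X)"
  proof (rule inj_onI)
    fix x x' assume x: "x \<in> mspace X" "x' \<in> mspace X" "f x = f x'"
    then have "mdist X x x' = mdist Y (f x) (f x)" using f(2) by metis
    also have "\<dots> = 0" using f(1) x by (auto simp: Pi_iff)
    finally show "x = x'" using x by simp
  qed
  ultimately show ?thesis using f(2) unfolding isometric_def bij_betw_def by blast
qed

section \<open>Distance zero means isometric\<close>

text \<open>Any selection from a correspondence of distortion at most \<open>e\<close> works, by
  \<open>abs_diff_le_Lam\<close>.\<close>

lemma dGH_eq_0_imp_almost_isometric_embedding:
  fixes e :: real
  assumes "1 \<le> p" "dGH p X Y = 0" "e > 0"
  shows "\<exists>f \<in> mspace X \<rightarrow> mspace Y. \<forall>x \<in> mspace X. \<forall>x' \<in> mspace X.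
        \<bar>mdist Y (f x) (f x') - mdist X x x'\<bar> \<le> e"
proof -
  have "dGH p X Y < ennreal (2 powr (- real_of_ereal (1 / p)) * e)"
    using assms by simp
  then obtain R where R: "R \<in> correspondences (mspace X) (mspace Y)"
    "\<And>x y x' y'. (x, y) \<in> R \<Longrightarrow> (x', y') \<in> R \<Longrightarrow> Lam p (mdist X x x') (mdist Y y y') \<le> e"
    using less_imp_le[OF assms(3)] by (rule dGH_lessD) blast
  have "\<forall>x \<in> mspace X. \<exists>y. (x, y) \<in> R"
    using R(1) by (simp add: correspondences_iff)
  then obtain f where f: "\<And>x. x \<in> mspace X \<Longrightarrow> (x, f x) \<in> R" by metis
  have "\<bar>mdist Y (f x) (f x') - mdist X x x'\<bar> \<le> e" if "x \<in> mspace X" "x' \<in> mspace X" for x x'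
    using abs_diff_le_Lam[OF assms(1), of "mdist X x x'" "mdist Y (f x) (f x')"]
      R(2)[OF f f, OF that] by (simp add: abs_minus_commute)
  moreover have "f \<in> mspace X \<rightarrow> mspace Y"
    using f R(1) unfolding correspondences_iff by blast
  ultimately show ?thesis by blast
qed

lemma dGH_eq_0_iff:
  assumes "1 \<le> p" "X \<in> compact_metrics" "Y \<in> compact_metrics"
  shows "dGH p X Y = 0 \<longleftrightarrow> isometric X Y"
proof
  assume XY0: "dGH p X Y = 0"
  then have YX: "dGH p Y X = 0" by (subst dGH_commute)
  have XY: "compact_space (mtopology_of X)" "compact_space (mtopology_of Y)"
    using assms by (simp_all add: compact_metrics_def)
  obtain f where "f \<in> mspace X \<rightarrow> mspace Y"
    "\<forall>x \<in> mspace X. \<forall>x' \<in> mspace X. mdist Y (f x) (f x') = mdist X x x'"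
    using almost_isometric_embeddings_imp_isometric_embedding[OF XY(2)
        dGH_eq_0_imp_almost_isometric_embedding[OF assms(1) XY0]] by (rule bexE)
  moreover obtain g where "g \<in> mspace Y \<rightarrow> mspace X"
    "\<forall>y \<in> mspace Y. \<forall>y' \<in> mspace Y. mdist X (g y) (g y') = mdist Y y y'"
    using almost_isometric_embeddings_imp_isometric_embedding[OF XY(1)
        dGH_eq_0_imp_almost_isometric_embedding[OF assms(1) YX]] by (rule bexE)
  ultimately show "isometric X Y"
    by (rule isometric_if_embeddings[OF XY(2)])
qed (rule isometric_imp_dGH_eq_0)

section \<open>Passage to isometry classes\<close>

text \<open>Passing to an isometric copy costs distance 0, which is neutral for
  \<open>boxplus\<close> in the p-triangle inequality.\<close>

lemma dGH_cong:
  fixes X X' Y Y' :: "'a metric"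
  assumes p: "1 \<le> p" and "(X, X') \<in> isometry_rel" "(Y, Y') \<in> isometry_rel"
  shows "enn2real (dGH p X Y) = enn2real (dGH p X' Y')"
proof -
  have left: "enn2real (dGH p X Y) \<le> enn2real (dGH p X' Y)"
    if "(X, X') \<in> isometry_rel" "Y \<in> compact_metrics" for X X' Y :: "'a metric"
    using dGH_triangle[OF p, of X X' Y] that isometric_imp_dGH_eq_0[of X X' p] p
    by (simp add: isometry_rel_def boxplus_0)
  \<comment> \<open>The arguments change one at a time; symmetry transports \<open>left\<close> to
    the second one.\<close>
  have le: "enn2real (dGH p X Y) \<le> enn2real (dGH p X' Y')"
    if "(X, X') \<in> isometry_rel" "(Y, Y') \<in> isometry_rel" for X X' Y Y' :: "'a metric"
    using left[OF that(1), of Y] left[OF that(2), of X'] that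
    by (simp add: dGH_commute[of p X'] isometry_rel_def)
  have "(X', X) \<in> isometry_rel" "(Y', Y) \<in> isometry_rel"
    using assms isometric_sym by (auto simp: isometry_rel_def)
  then show ?thesis using le assms(2,3) by (intro order_antisym)
qed

text \<open>The representatives picked by \<open>SOME\<close> are isometric to the given ones, so
  \<open>dGH_cong\<close> makes the choice irrelevant.\<close>

lemma GH_dist_classes:
  fixes X Y :: "'a metric"
  assumes "1 \<le> p" "X \<in> compact_metrics" "Y \<in> compact_metrics"
  shows "GH_dist p (isometry_rel `` {X}) (isometry_rel `` {Y}) = enn2real (dGH p X Y)"
proof -
  have rep: "(Z, SOME W. W \<in> isometry_rel `` {Z}) \<in> isometry_rel"
    if "Z \<in> compact_metrics" for Z :: "'a metric"
  proof -
    have "Z \<in> isometry_rel `` {Z}"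
      by (rule equiv_class_self[OF equiv_isometry_rel that])
    then have "(SOME W. W \<in> isometry_rel `` {Z}) \<in> isometry_rel `` {Z}"
      by (rule someI)
    then show ?thesis by (rule Image_singleton_iff[THEN iffD1])
  qed
  show ?thesis
    unfolding GH_dist_def by (rule dGH_cong[OF assms(1) rep rep, symmetric]) fact+
qed

text \<open>Every type is inhabited and so carries a one-point space; \<open>p_metric_space\<close>
  demands a nonempty carrier.\<close>

lemma compact_metrics_nonempty: "(compact_metrics :: 'a metric set) \<noteq> {}"
proof -
  define X where "X = metric ({undefined :: 'a}, \<lambda>_ _. 0 :: real)"
  have "Metric_space {undefined :: 'a} (\<lambda>_ _. 0)" by unfold_locales auto
  then have X: "mspace X = {undefined}"
    unfolding X_def by (rule Metric_space.mspace_metric)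
  have "compactin (mtopology_of X) (topspace (mtopology_of X))"
    by (rule finite_imp_compactin) (simp_all add: X)
  then have "X \<in> compact_metrics"
    unfolding compact_metrics_def compact_space_def by (simp add: X)
  then show ?thesis by (rule ex_in_conv[THEN iffD1, OF exI])
qed

text \<open>The first conjunct certifies that \<open>GH_dist\<close> is faithful: it depends on no
  choice of representatives, and \<open>enn2real\<close> hides no infinite value.\<close>

theorem theorem4p2:
  fixes p :: ereal
  assumes "1 \<le> p"
  shows "(\<forall>X \<in> (compact_metrics :: 'a metric set). \<forall>Y \<in> (compact_metrics :: 'a metric set).
            ennreal (GH_dist p (isometry_rel `` {X}) (isometry_rel `` {Y})) = dGH p X Y) \<and>
         p_metric_space p (GH_classes :: 'a metric set set) (GH_dist p)"
proof -
  have nonneg: "0 \<le> GH_dist p C D" for C D :: "'a metric set"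
    by (simp add: GH_dist_def)
  have commute: "GH_dist p C D = GH_dist p D C" for C D :: "'a metric set"
    unfolding GH_dist_def by (subst dGH_commute) (rule refl)
  have zero: "GH_dist p C D = 0 \<longleftrightarrow> C = D"
    if C: "C \<in> GH_classes" and D: "D \<in> GH_classes" for C D :: "'a metric set"
  proof -
    obtain X Y where XY: "X \<in> compact_metrics" "Y \<in> compact_metrics"
      and eq: "C = isometry_rel `` {X}" "D = isometry_rel `` {Y}"
      using C D unfolding GH_classes_def by (elim quotientE)
    \<comment> \<open>\<open>enn2real\<close> sends \<open>top\<close> to 0 as well; finiteness
      rules that case out.\<close>
    have "GH_dist p C D = 0 \<longleftrightarrow> dGH p X Y = 0"
      using dGH_finite[OF assms XY]
      by (auto simp: eq GH_dist_classes[OF assms XY] enn2real_eq_0_iff)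
    also have "\<dots> \<longleftrightarrow> C = D"
      unfolding eq eq_equiv_class_iff[OF equiv_isometry_rel XY]
      using dGH_eq_0_iff[OF assms XY] XY by (simp add: isometry_rel_def)
    finally show ?thesis .
  qed
  have triangle: "GH_dist p C E \<le> boxplus p (GH_dist p C D) (GH_dist p D E)"
    if C: "C \<in> GH_classes" and D: "D \<in> GH_classes" and E: "E \<in> GH_classes"
    for C D E :: "'a metric set"
  proof -
    obtain X Y Z where "X \<in> compact_metrics" "Y \<in> compact_metrics" "Z \<in> compact_metrics"
      and "C = isometry_rel `` {X}" "D = isometry_rel `` {Y}" "E = isometry_rel `` {Z}"
      using C D E unfolding GH_classes_def by (elim quotientE)
    then show ?thesis
      using dGH_triangle[OF assms] by (simp add: GH_dist_classes assms)
  qed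
  have "Metric_space (GH_classes :: 'a metric set set) (GH_dist p)"
  proof
    fix C D E :: "'a metric set"
    assume "C \<in> GH_classes" "D \<in> GH_classes" "E \<in> GH_classes"
    then show "GH_dist p C E \<le> GH_dist p C D + GH_dist p D E"
      using triangle boxplus_le_add[OF assms nonneg nonneg] order_trans by blast
  qed (use nonneg commute zero in auto)
  moreover have "(GH_classes :: 'a metric set set) \<noteq> {}"
    using compact_metrics_nonempty by (auto simp: GH_classes_def quotient_def)
  ultimately have "p_metric_space p (GH_classes :: 'a metric set set) (GH_dist p)"
    using triangle by (auto simp: p_metric_space_def)
  moreover have "ennreal (GH_dist p (isometry_rel `` {X}) (isometry_rel `` {Y})) = dGH p X Y"
    if "X \<in> compact_metrics" "Y \<in> compact_metrics" for X Y :: "'a metric"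
    unfolding GH_dist_classes[OF assms that] by (rule ennreal_enn2real_dGH[OF assms that])
  ultimately show ?thesis by blast
qed

end
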